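(* Let $f(z)=\sum_{k=0}^\infty d_k z^k$, with $d_k\in\mathbb{C}\setminus\{0\}$ for all $k\ge 0$ and $d_0=1$, be a power series with non-zero radius of convergence $\rho$, $0<\rho\le+\infty$. Let $f_n(z)=\sum_{k=0}^n d_k z^k$ be its $n$-th partial sum, and let $$R_{2n}(z)=\frac{f_{2n}(z)}{z^n},\qquad R_{2n+1}(z)=\frac{f_{2n+1}(z)}{z^{n+1}},\qquad n=0,1,2,\dots$$ Let $\mathbf{L}:\mathcal{A}\to\mathbb{C}$ be a linear functional with $\mathbf{L}(1)=1$ such that $\mathbf{L}(R_nR_m)=0$ whenever $n\neq m$, and $\mathbf{L}(R_n^2)\neq 0$, for all integers $n,m\ge 0$. Then $$\mathbf{L}(R)=\frac{1}{2\pi i}\oint_{|y|=c}R(y^2)\,\frac{dy}{y\,f(y^2)},\qquad R\in\mathcal{A}.$$ Here $c$ is an arbitrary positive number which is less than $\sqrt{\rho}$ and less than $\widehat{\rho}$, where $\widehat{\rho}$ is the radius of convergence of the Maclaurin series of $1/f(y^2)$ (as a function of $y$).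
   Context: $\mathcal{A}$ denotes the complex vector space (algebra) of all Laurent polynomials in one indeterminate with complex coefficients, i.e. finite sums $\sum_{j=p}^{p+q}\lambda_j x^j$ with $p\in\mathbb{Z}$, $q\in\mathbb{Z}$, $q\ge 0$, $\lambda_j\in\mathbb{C}$. The circle $|y|=c$ is traversed once counterclockwise. Since $f(0)=1$, one has $\widehat{\rho}>0$; $\sqrt{\rho}$ and $\widehat{\rho}$ may equal $+\infty$. *)

theory Defs
  imports "HOL-Library.Poly_Mapping" "HOL-Complex_Analysis.Complex_Analysis"
begin

text \<open>
  Laurent polynomials are the finitely supported functions from exponents in \<open>\<int>\<close> to coefficients;
  the ring structure (convolution) is the one of \<^theory>\<open>HOL-Library.Poly_Mapping\<close>.
\<close>

type_synonym laurent_poly = "int \<Rightarrow>\<^sub>0 complex"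

definition lp_scale :: "complex \<Rightarrow> laurent_poly \<Rightarrow> laurent_poly" where
  "lp_scale a p = Poly_Mapping.map ((*) a) p"

lemma lp_scale_conv_mult: "lp_scale a p = Poly_Mapping.single 0 a * p"
  by (simp add: lp_scale_def mult_map_scale_conv_mult)

lemma vector_space_lp_scale: "vector_space lp_scale"
  by unfold_locales
    (simp_all add: lp_scale_conv_mult algebra_simps single_add mult_single flip: mult.assoc)

abbreviation lp_linear_functional :: "(laurent_poly \<Rightarrow> complex) \<Rightarrow> bool" where
  "lp_linear_functional \<equiv> Vector_Spaces.linear lp_scale (*)"

lemma lp_linear_functional_iff:
  "lp_linear_functional L \<longleftrightarrow>
     (\<forall>p q. L (p + q) = L p + L q) \<and> (\<forall>a p. L (lp_scale a p) = a * L p)"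
proof -
  have "vector_space ((*) :: complex \<Rightarrow> complex \<Rightarrow> complex)"
    by unfold_locales (simp_all add: algebra_simps)
  then show ?thesis
    by (auto simp: Vector_Spaces.linear_iff vector_space_lp_scale)
qed

definition lp_eval :: "laurent_poly \<Rightarrow> complex \<Rightarrow> complex" where
  "lp_eval p z = (\<Sum>k\<in>Poly_Mapping.keys p. Poly_Mapping.lookup p k * z powi k)"

definition lp_partial_sum :: "(nat \<Rightarrow> complex) \<Rightarrow> nat \<Rightarrow> laurent_poly" where
  "lp_partial_sum d n = (\<Sum>k\<le>n. Poly_Mapping.single (int k) (d k))"

definition lp_R :: "(nat \<Rightarrow> complex) \<Rightarrow> nat \<Rightarrow> laurent_poly" where
  "lp_R d m = Poly_Mapping.single (- int (if even m then m div 2 else m div 2 + 1)) 1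
                * lp_partial_sum d m"

lemma lp_R_even: "lp_R d (2 * n) = Poly_Mapping.single (- int n) 1 * lp_partial_sum d (2 * n)"
  by (simp add: lp_R_def)

lemma lp_R_odd:
  "lp_R d (2 * n + 1) = Poly_Mapping.single (- int (n + 1)) 1 * lp_partial_sum d (2 * n + 1)"
  by (simp add: lp_R_def)

definition ereal_sqrt :: "ereal \<Rightarrow> ereal" where
  "ereal_sqrt r = (case r of ereal x \<Rightarrow> ereal (sqrt x) | PInfty \<Rightarrow> \<infinity> | MInfty \<Rightarrow> -\<infinity>)"

text \<open>
  Radius of convergence of the Maclaurin series of \<open>y \<mapsto> 1 / f(y\<^sup>2)\<close>, for \<open>f\<close> the sum of the power
  series \<open>F\<close>. The coefficients only depend on the germ at \<open>0\<close>, so the values of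
  \<^const>\<open>eval_fps\<close> outside the disc of convergence of \<open>F\<close> do not matter.
\<close>

definition rho_hat :: "complex fps \<Rightarrow> ereal" where
  "rho_hat F = fps_conv_radius (fps_expansion (\<lambda>y. 1 / eval_fps F (y\<^sup>2)) 0)"

end

theory Submission
  imports Defs
begin

text \<open>
  Since \<open>R\<^sub>0 = 1\<close>, orthogonality to \<open>R\<^sub>0\<close> says that \<open>L\<close> annihilates every \<open>R\<^sub>n\<close> with
  \<open>n \<ge> 1\<close>. The exponents of \<open>R\<^sub>n\<close> fill a window of \<open>n + 1\<close> consecutive integers, and passing from
  \<open>n\<close> to \<open>n + 1\<close> extends the window by one exponent, alternately below and above. The coefficient
  at the new exponent is \<open>d\<^sub>0\<close> or \<open>d\<^bsub>n+1\<^esub>\<close>, hence non-zero, so the values \<open>L(R\<^sub>n)\<close> determine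
  the moments \<open>L(x\<^sup>k)\<close> one after the other (\<open>staircase_recurrence_unique\<close>).

  The functional with \<open>x\<^sup>-\<^sup>k \<mapsto> e\<^sub>k\<close> for \<open>k \<ge> 0\<close> and \<open>x\<^sup>k \<mapsto> 0\<close> for \<open>k > 0\<close>, where
  \<open>1/f = \<Sum> e\<^sub>k z\<^sup>k\<close>, has the same values on all \<open>R\<^sub>n\<close>: applied to \<open>R\<^sub>n = x\<^sup>-\<^sup>m f\<^sub>n\<close> with
  \<open>1 \<le> m \<le> n\<close> it gives the \<open>m\<close>-th coefficient of \<open>f \<cdot> 1/f = 1\<close>, because the terms of \<open>f\<^sub>n\<close> of
  degree above \<open>m\<close> are sent to \<open>0\<close> (\<open>recip_moment_partial_sum\<close>). So \<open>L\<close> is that functional.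

  Finally the contour integral of \<open>y\<^bsup>2k\<^esup> / (y f(y\<^sup>2))\<close> picks out the coefficient of \<open>y\<^bsup>-2k\<^esup>\<close> in
  \<open>1/f(y\<^sup>2)\<close>, by Cauchy's formula (\<open>recip_moment_contour\<close>). This needs \<open>1/f(y\<^sup>2)\<close> to be holomorphic
  on a disc of radius larger than \<open>c\<close>. There \<open>f(y\<^sup>2)\<close> and the Maclaurin series of \<open>1/f(y\<^sup>2)\<close> both
  converge and their product is \<open>1\<close> by analytic continuation, so \<open>f(y\<^sup>2)\<close> has no zero
  (\<open>eval_fps_square_nonzero\<close>).
\<close>


section \<open>Linear functionals on Laurent polynomials\<close>

lemma lp_functional_sum:
  assumes "lp_linear_functional L"
  shows "L (sum g A) = (\<Sum>a\<in>A. L (g a))"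
proof -
  interpret Vector_Spaces.linear lp_scale "(*)" L by (rule assms)
  show ?thesis by (rule sum)
qed

lemma lp_functional_single:
  assumes "lp_linear_functional L"
  shows "L (Poly_Mapping.single k a) = a * L (Poly_Mapping.single k 1)"
proof -
  have "Poly_Mapping.single k a = lp_scale a (Poly_Mapping.single k 1)"
    by (simp add: lp_scale_conv_mult mult_single)
  then show ?thesis
    using assms by (simp add: lp_linear_functional_iff)
qed

lemma lp_functional_eq_sum_moments:
  assumes "lp_linear_functional L"
  shows "L p = (\<Sum>k\<in>Poly_Mapping.keys p. Poly_Mapping.lookup p k * L (Poly_Mapping.single k 1))"
proof -
  have "p = (\<Sum>k\<in>Poly_Mapping.keys p. Poly_Mapping.single k (Poly_Mapping.lookup p k))"
    by (rule poly_mapping_eqI)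
      (auto simp: lookup_sum lookup_single when_def in_keys_iff)
  then have "L p = (\<Sum>k\<in>Poly_Mapping.keys p. L (Poly_Mapping.single k (Poly_Mapping.lookup p k)))"
    using lp_functional_sum[OF assms] by metis
  also have "\<dots> = (\<Sum>k\<in>Poly_Mapping.keys p. Poly_Mapping.lookup p k * L (Poly_Mapping.single k 1))"
    by (intro sum.cong refl lp_functional_single[OF assms])
  finally show ?thesis .
qed

lemma lp_functional_lp_R:
  assumes "lp_linear_functional L"
  shows "L (lp_R d n) =
    (\<Sum>j\<le>n. d j * L (Poly_Mapping.single (int j - int ((n + 1) div 2)) 1))"
proof -
  have "(if even n then n div 2 else n div 2 + 1) = (n + 1) div 2"
    by (auto elim!: evenE oddE)
  then have "lp_R d n = (\<Sum>j\<le>n. Poly_Mapping.single (int j - int ((n + 1) div 2)) (d j))"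
    by (simp only: lp_R_def lp_partial_sum_def sum_distrib_left mult_single)
       (simp add: algebra_simps)
  then have "L (lp_R d n) = (\<Sum>j\<le>n. L (Poly_Mapping.single (int j - int ((n + 1) div 2)) (d j)))"
    by (simp add: lp_functional_sum[OF assms])
  also have "\<dots> = (\<Sum>j\<le>n. d j * L (Poly_Mapping.single (int j - int ((n + 1) div 2)) 1))"
    by (intro sum.cong refl lp_functional_single[OF assms])
  finally show ?thesis .
qed


section \<open>The moments of the functional\<close>

text \<open>
  The equation for \<open>n + 1\<close> involves exactly one value of \<open>\<delta>\<close> that does not occur in the window of
  \<open>n\<close>: the lowest one (with coefficient \<open>d 0\<close>) when \<open>n\<close> is even, the highest one (with coefficient
  \<open>d (n + 1)\<close>) when \<open>n\<close> is odd.
\<close>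

lemma staircase_recurrence_unique:
  fixes d :: "nat \<Rightarrow> 'a :: idom" and \<delta> :: "int \<Rightarrow> 'a"
  assumes nz: "\<And>k. d k \<noteq> 0"
    and zero: "\<And>n. (\<Sum>j\<le>n. d j * \<delta> (int j - int ((n + 1) div 2))) = 0"
  shows "\<delta> k = 0"
proof -
  have window: "\<forall>j\<le>n. \<delta> (int j - int ((n + 1) div 2)) = 0" for n
  proof (induction n)
    case 0
    then show ?case using zero[of 0] nz[of 0] by simp
  next
    case (Suc n)
    let ?m = "(Suc n + 1) div 2"
    show ?case
    proof (cases "even n")
      case True
      then have m: "?m = Suc ((n + 1) div 2)" by (auto elim!: evenE)
      have rest: "\<delta> (int (Suc j) - int ?m) = 0" if "j \<le> n" for j
        using Suc.IH that m by simp
      have "d 0 * \<delta> (int 0 - int ?m) = 0"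
        using zero[of "Suc n"] rest by (simp add: sum.atMost_Suc_shift del: sum.atMost_Suc)
      then have "\<delta> (int 0 - int ?m) = 0" using nz by simp
      then show ?thesis using rest by (metis Suc_le_mono not0_implies_Suc)
    next
      case False
      then have m: "?m = (n + 1) div 2" by (auto elim!: oddE)
      have rest: "\<delta> (int j - int ?m) = 0" if "j \<le> n" for j
        using Suc.IH that m by simp
      have "d (Suc n) * \<delta> (int (Suc n) - int ?m) = 0"
        using zero[of "Suc n"] rest by simp
      then have "\<delta> (int (Suc n) - int ?m) = 0" using nz by simp
      then show ?thesis using rest by (metis le_Suc_eq)
    qed
  qed
  \<comment> \<open>The window of \<open>2N\<close> is the set of exponents from \<open>-N\<close> to \<open>N\<close>.\<close>
  have "nat (k + \<bar>k\<bar>) \<le> 2 * nat \<bar>k\<bar>" by linarith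
  then have "\<delta> (int (nat (k + \<bar>k\<bar>)) - int ((2 * nat \<bar>k\<bar> + 1) div 2)) = 0"
    using window[of "2 * nat \<bar>k\<bar>"] by blast
  moreover have "int (nat (k + \<bar>k\<bar>)) - int ((2 * nat \<bar>k\<bar> + 1) div 2) = k" by simp
  ultimately show ?thesis by simp
qed

text \<open>
  The \<open>k\<close>-th moment of the functional \<open>R \<mapsto> [z\<^sup>0] R(z) / F(z)\<close>.
\<close>

definition recip_moment :: "'a :: field fps \<Rightarrow> int \<Rightarrow> 'a" where
  "recip_moment F k = (if k > 0 then 0 else fps_nth (inverse F) (nat (- k)))"

text \<open>
  The sum is a coefficient of \<open>F * inverse F = 1\<close>: the summands with \<open>j > m\<close> vanish, and the
  condition \<open>m \<le> n\<close> ensures that no summand of the Cauchy product is missing.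
\<close>

lemma recip_moment_partial_sum:
  fixes F :: "'a :: field fps"
  assumes F0: "fps_nth F 0 \<noteq> 0" and "m \<le> n"
  shows "(\<Sum>j\<le>n. fps_nth F j * recip_moment F (int j - int m)) = (if m = 0 then 1 else 0)"
proof -
  have "(\<Sum>j\<le>n. fps_nth F j * recip_moment F (int j - int m)) =
        (\<Sum>j\<le>m. fps_nth F j * recip_moment F (int j - int m))"
    using \<open>m \<le> n\<close> by (intro sum.mono_neutral_right) (auto simp: recip_moment_def)
  also have "\<dots> = (\<Sum>j\<le>m. fps_nth F j * fps_nth (inverse F) (m - j))"
    by (intro sum.cong) (auto simp: recip_moment_def nat_diff_distrib)
  also have "\<dots> = fps_nth (F * inverse F) m"
    by (simp add: fps_mult_nth atLeast0AtMost)
  also have "\<dots> = (if m = 0 then 1 else 0)"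
    using inverse_mult_eq_1[OF F0] by (simp add: mult.commute)
  finally show ?thesis .
qed

lemma lp_functional_moments:
  assumes nz: "\<And>k. d k \<noteq> 0" and d0: "d 0 = 1"
    and lin: "lp_linear_functional L" and L1: "L 1 = 1"
    and LR: "\<And>n. n \<noteq> 0 \<Longrightarrow> L (lp_R d n) = 0"
  shows "L (Poly_Mapping.single k 1) = recip_moment (Abs_fps d) k"
proof -
  define \<delta> where "\<delta> k = L (Poly_Mapping.single k 1) - recip_moment (Abs_fps d) k" for k
  have "(\<Sum>j\<le>n. d j * \<delta> (int j - int ((n + 1) div 2))) = 0" for n
  proof -
    have "(\<Sum>j\<le>n. d j * \<delta> (int j - int ((n + 1) div 2))) =
      L (lp_R d n) - (\<Sum>j\<le>n. d j * recip_moment (Abs_fps d) (int j - int ((n + 1) div 2)))"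
      by (simp add: \<delta>_def lp_functional_lp_R[OF lin] right_diff_distrib sum_subtractf)
    also have "(\<Sum>j\<le>n. d j * recip_moment (Abs_fps d) (int j - int ((n + 1) div 2))) =
        (if n = 0 then 1 else 0)"
      using recip_moment_partial_sum[of "Abs_fps d" "(n + 1) div 2" n] nz by auto
    also have "L (lp_R d n) = (if n = 0 then 1 else 0)"
      using L1 LR d0 by (auto simp: lp_R_def lp_partial_sum_def)
    finally show ?thesis by simp
  qed
  then have "\<delta> k = 0" by (rule staircase_recurrence_unique[OF nz])
  then show ?thesis by (simp add: \<delta>_def)
qed


section \<open>The contour integral\<close>

lemma fps_nth_compose_X_square:
  "fps_nth (F oo fps_X ^ 2) (2 * m) = fps_nth F m"
proof -
  have "fps_nth (F oo fps_X ^ 2) (2 * m) = (\<Sum>i=0..2*m. if i = m then fps_nth F i else 0)"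
    unfolding fps_compose_nth by (intro sum.cong) (auto simp flip: power_mult)
  then show ?thesis by simp
qed

lemma eval_fps_square_expansion:
  fixes F :: "complex fps"
  assumes "fps_conv_radius F > 0"
  shows "(\<lambda>y. eval_fps F (y\<^sup>2)) has_fps_expansion (F oo fps_X ^ 2)"
proof -
  have "(eval_fps F \<circ> (\<lambda>y. y ^ 2)) has_fps_expansion (F oo fps_X ^ 2)"
    by (intro fps_expansion_intros eval_fps_has_fps_expansion assms) auto
  then show ?thesis by (simp add: o_def)
qed

lemma recip_eval_fps_square_expansion:
  fixes F :: "complex fps"
  assumes "fps_conv_radius F > 0" and "fps_nth F 0 \<noteq> 0"
  shows "(\<lambda>y. 1 / eval_fps F (y\<^sup>2)) has_fps_expansion (inverse F oo fps_X ^ 2)"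
proof -
  have "(\<lambda>y. inverse (eval_fps F (y\<^sup>2))) has_fps_expansion inverse (F oo fps_X ^ 2)"
    using assms by (intro has_fps_expansion_inverse eval_fps_square_expansion) auto
  then show ?thesis
    using assms by (simp add: fps_inverse_compose inverse_eq_divide)
qed

lemma norm_square_less_of_less_ereal_sqrt:
  assumes "ereal r \<le> ereal_sqrt R" and "norm (y :: complex) < r" and "R > 0"
  shows "ereal (norm (y\<^sup>2)) < R"
proof (cases R)
  case (real s)
  then have "norm y < sqrt s" using assms by (simp add: ereal_sqrt_def)
  then have "(norm y)\<^sup>2 < s"
    by (metis norm_ge_zero not_less real_le_lsqrt)
  then show ?thesis using real by (simp add: norm_power)
qed (use assms in auto)

lemma eval_fps_square_holomorphic:
  fixes F :: "complex fps"
  assumes "fps_conv_radius F > 0" and "ereal r \<le> ereal_sqrt (fps_conv_radius F)"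
  shows "(\<lambda>y. eval_fps F (y\<^sup>2)) holomorphic_on ball 0 r"
proof -
  have "(eval_fps F \<circ> (\<lambda>y. y\<^sup>2)) holomorphic_on ball 0 r"
    using norm_square_less_of_less_ereal_sqrt[OF assms(2) _ assms(1)]
    by (intro holomorphic_on_compose holomorphic_on_eval_fps holomorphic_intros) auto
  then show ?thesis by (simp add: o_def)
qed

text \<open>
  The product of \<open>F(y\<^sup>2)\<close> with the Maclaurin series of its reciprocal is \<open>1\<close> near \<open>0\<close>; as both
  factors are holomorphic on the whole disc, the identity theorem extends this to the disc and
  excludes a zero of \<open>F(y\<^sup>2)\<close>.
\<close>

lemma eval_fps_square_nonzero:
  fixes F :: "complex fps"
  assumes radius: "fps_conv_radius F > 0" and F0: "fps_nth F 0 \<noteq> 0"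
    and r: "ereal r \<le> ereal_sqrt (fps_conv_radius F)" "ereal r \<le> rho_hat F"
    and y: "norm y < r"
  shows "eval_fps F (y\<^sup>2) \<noteq> 0"
proof -
  define G where "G = inverse F oo fps_X ^ 2"
  have expG: "(\<lambda>y. 1 / eval_fps F (y\<^sup>2)) has_fps_expansion G"
    unfolding G_def by (rule recip_eval_fps_square_expansion[OF radius F0])
  have radG: "ereal r \<le> fps_conv_radius G"
    using r(2) fps_expansion_eqI[OF expG] by (simp add: rho_hat_def)
  have "\<forall>\<^sub>F y in nhds 0. eval_fps F (y\<^sup>2) \<noteq> 0"
  proof -
    have "isCont (\<lambda>y. eval_fps F (y\<^sup>2)) 0"
      using has_fps_expansion_imp_continuous[OF eval_fps_square_expansion[OF radius]] .
    moreover have "eval_fps F (0\<^sup>2) \<noteq> 0" using F0 by (simp add: eval_fps_at_0)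
    ultimately obtain e where "e > 0" "\<And>y. dist 0 y < e \<Longrightarrow> eval_fps F (y\<^sup>2) \<noteq> 0"
      using continuous_at_avoid[of 0 "\<lambda>y. eval_fps F (y\<^sup>2)" 0] by auto
    then show ?thesis
      unfolding eventually_nhds_metric by (auto simp: dist_commute)
  qed
  moreover have "\<forall>\<^sub>F y in nhds 0. eval_fps G y = 1 / eval_fps F (y\<^sup>2)"
    using expG by (simp add: has_fps_expansion_def)
  ultimately have "\<forall>\<^sub>F y in nhds 0. eval_fps F (y\<^sup>2) * eval_fps G y = 1"
    by eventually_elim simp
  then obtain e where e: "e > 0" "\<And>z. dist z 0 < e \<Longrightarrow> eval_fps F (z\<^sup>2) * eval_fps G z = 1"
    unfolding eventually_nhds_metric by blast
  have r0: "r > 0" using y by (meson le_less_trans norm_ge_zero)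
  have "eval_fps F (y\<^sup>2) * eval_fps G y = 1"
  proof (rule analytic_continuation_open
      [where s = "ball 0 (min e r)" and s' = "ball 0 r"
        and f = "\<lambda>y. eval_fps F (y\<^sup>2) * eval_fps G y" and g = "\<lambda>_. 1"])
    have "(\<lambda>y. eval_fps F (y\<^sup>2)) holomorphic_on ball 0 r"
      by (rule eval_fps_square_holomorphic[OF radius r(1)])
    moreover have "eval_fps G holomorphic_on ball 0 r"
    proof (intro holomorphic_on_eval_fps subsetI)
      fix x :: complex assume "x \<in> ball 0 r"
      then have "ereal (norm x) < ereal r" by simp
      also note radG
      finally show "x \<in> eball 0 (fps_conv_radius G)" by simp
    qed
    ultimately show "(\<lambda>y. eval_fps F (y\<^sup>2) * eval_fps G y) holomorphic_on ball 0 r"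
      by (rule holomorphic_on_mult)
  qed (use e r0 y in auto)
  then show ?thesis by auto
qed

lemma recip_eval_fps_square_holomorphic:
  fixes F :: "complex fps"
  assumes radius: "fps_conv_radius F > 0" and F0: "fps_nth F 0 \<noteq> 0"
    and r: "ereal r \<le> ereal_sqrt (fps_conv_radius F)" "ereal r \<le> rho_hat F"
  shows "(\<lambda>y. 1 / eval_fps F (y\<^sup>2)) holomorphic_on ball 0 r"
proof -
  show ?thesis
    using eval_fps_square_nonzero[OF assms]
    by (auto intro!: holomorphic_intros eval_fps_square_holomorphic[OF radius r(1)])
qed

text \<open>
  For \<open>k > 0\<close> the integrand extends holomorphically over \<open>0\<close>. Otherwise it is
  \<open>(1 / F(y\<^sup>2)) / y ^ (2 \<bar>k\<bar> + 1)\<close>, and Cauchy's formula for derivatives yields the coefficient of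
  \<open>y ^ (2 \<bar>k\<bar>)\<close> in \<open>1 / F(y\<^sup>2)\<close>.
\<close>

lemma recip_moment_contour:
  fixes F :: "complex fps"
  assumes radius: "fps_conv_radius F > 0" and F0: "fps_nth F 0 \<noteq> 0"
    and c: "0 < c" "ereal c < ereal_sqrt (fps_conv_radius F)" "ereal c < rho_hat F"
  shows "((\<lambda>y. (y\<^sup>2) powi k / (y * eval_fps F (y\<^sup>2))) has_contour_integral
            2 * of_real pi * \<i> * recip_moment F k) (circlepath 0 c)"
proof -
  define h where "h = (\<lambda>y. 1 / eval_fps F (y\<^sup>2))"
  obtain r where r: "ereal c < ereal r"
      "ereal r \<le> ereal_sqrt (fps_conv_radius F)" "ereal r \<le> rho_hat F"
    using ereal_dense2[of "ereal c" "min (ereal_sqrt (fps_conv_radius F)) (rho_hat F)"] c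
    by auto
  have hol: "h holomorphic_on ball 0 r"
    unfolding h_def by (rule recip_eval_fps_square_holomorphic[OF radius F0 r(2,3)])
  show ?thesis
  proof (cases "k > 0")
    case True
    have "((\<lambda>y. h y * y ^ (2 * nat k - 1)) has_contour_integral 0) (circlepath 0 c)"
      using r(1) c(1) by (intro Cauchy_theorem_disc_simple[where a = 0 and e = r] holomorphic_intros hol) auto
    then have "((\<lambda>y. (y\<^sup>2) powi k / (y * eval_fps F (y\<^sup>2))) has_contour_integral 0) (circlepath 0 c)"
    proof (rule has_contour_integral_eq)
      fix y assume "y \<in> path_image (circlepath 0 c)"
      then have "y \<noteq> 0" using c(1) by auto
      moreover have "(y\<^sup>2) powi k = y * y ^ (2 * nat k - 1)"
        using True by (simp add: power_int_def flip: power_mult power_Suc)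
      ultimately show "h y * y ^ (2 * nat k - 1) = (y\<^sup>2) powi k / (y * eval_fps F (y\<^sup>2))"
        by (simp add: h_def)
    qed
    then show ?thesis using True by (simp add: recip_moment_def)
  next
    case False
    define m where "m = nat (- k)"
    have "((\<lambda>u. h u / (u - 0) ^ Suc (2 * m)) has_contour_integral
        (2 * pi * \<i>) / fact (2 * m) * (deriv ^^ (2 * m)) h 0) (circlepath 0 c)"
      using r(1) c(1)
      by (intro Cauchy_has_contour_integral_higher_derivative_circlepath
                holomorphic_on_imp_continuous_on holomorphic_on_subset[OF hol]) auto
    moreover have "recip_moment F k = (deriv ^^ (2 * m)) h 0 / fact (2 * m)"
      using fps_nth_fps_expansion[OF recip_eval_fps_square_expansion[OF radius F0], of "2 * m"] False
      by (simp add: fps_nth_compose_X_square h_def recip_moment_def m_def)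
    ultimately have "((\<lambda>u. h u / u ^ Suc (2 * m)) has_contour_integral
        2 * of_real pi * \<i> * recip_moment F k) (circlepath 0 c)"
      by simp
    then show ?thesis
    proof (rule has_contour_integral_eq)
      fix y assume "y \<in> path_image (circlepath 0 c)"
      then have "y \<noteq> 0" using c(1) by auto
      moreover have "(y\<^sup>2) powi k = 1 / y ^ (2 * m)"
        using False
        by (cases "k = 0") (simp_all add: power_int_def m_def power_mult field_simps power2_eq_square power_mult_distrib)
      ultimately show "h y / y ^ Suc (2 * m) = (y\<^sup>2) powi k / (y * eval_fps F (y\<^sup>2))"
        by (simp add: h_def)
    qed
  qed
qed


section \<open>The integral representation\<close>

theorem theorem2:
  fixes d :: "nat \<Rightarrow> complex" and L :: "laurent_poly \<Rightarrow> complex"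
    and F :: "complex fps" and c :: real and R :: laurent_poly
  assumes d_nz: "\<And>k. d k \<noteq> 0" and d_0: "d 0 = 1"
    and F_def: "F = Abs_fps d"
    and radius: "fps_conv_radius F > 0"
    and L_linear: "lp_linear_functional L"
    and L_1: "L 1 = 1"
    and L_orth: "\<And>n m. n \<noteq> m \<Longrightarrow> L (lp_R d n * lp_R d m) = 0"
    and L_norm: "\<And>n. L ((lp_R d n)\<^sup>2) \<noteq> 0"
    and c_pos: "c > 0"
    and c_sqrt: "ereal c < ereal_sqrt (fps_conv_radius F)"
    and c_hat: "ereal c < rho_hat F"
  shows "(\<lambda>y. lp_eval R (y\<^sup>2) / (y * eval_fps F (y\<^sup>2))) contour_integrable_on circlepath 0 c
    \<and> L R = 1 / (2 * of_real pi * \<i>) *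
        contour_integral (circlepath 0 c) (\<lambda>y. lp_eval R (y\<^sup>2) / (y * eval_fps F (y\<^sup>2)))"
proof -
  have F0: "fps_nth F 0 \<noteq> 0"
    using d_nz by (simp add: F_def)
  have "lp_R d 0 = 1"
    using d_0 by (simp add: lp_R_def lp_partial_sum_def)
  then have "L (lp_R d n) = 0" if "n \<noteq> 0" for n
    using L_orth[OF that] by simp
  then have moment: "L (Poly_Mapping.single k 1) = recip_moment F k" for k
    unfolding F_def using d_nz d_0 L_linear L_1 by (intro lp_functional_moments)
  have "((\<lambda>y. \<Sum>k\<in>Poly_Mapping.keys R.
            Poly_Mapping.lookup R k * ((y\<^sup>2) powi k / (y * eval_fps F (y\<^sup>2))))
          has_contour_integral
            (\<Sum>k\<in>Poly_Mapping.keys R.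
              Poly_Mapping.lookup R k * (2 * of_real pi * \<i> * recip_moment F k)))
          (circlepath 0 c)"
    by (intro has_contour_integral_sum has_contour_integral_lmul
          recip_moment_contour[OF radius F0 c_pos c_sqrt c_hat]) auto
  moreover have "(\<Sum>k\<in>Poly_Mapping.keys R.
      Poly_Mapping.lookup R k * (2 * of_real pi * \<i> * recip_moment F k)) = 2 * of_real pi * \<i> * L R"
    by (simp add: lp_functional_eq_sum_moments[OF L_linear, of R] moment sum_distrib_left mult_ac)
  ultimately have integral: "((\<lambda>y. lp_eval R (y\<^sup>2) / (y * eval_fps F (y\<^sup>2)))
      has_contour_integral 2 * of_real pi * \<i> * L R) (circlepath 0 c)"
    by (simp add: lp_eval_def sum_divide_distrib)
  then show ?thesis
    by (auto simp: contour_integral_unique contour_integrable_on_def)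
qed

end
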